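(* Let $u_0\in L^\infty(\Omega)$ and let $s_1<s_2$ be real constants with $s_1,s_2\notin(s_*,s^* )$ and $s_1\le u_0(x)\le s_2$ for a.e. $x\in\Omega$. Then there exists a unique time-global solution $u\in C^1([0,\infty);L^\infty(\Omega))$ of Problem $(P)$ with initial data $u_0$. Moreover, $$\int_\Omega u(x,t)\,dx=\int_\Omega u_0(x)\,dx\quad\text{for all } t\ge 0,$$ and, for all $t\ge 0$, $$s_1\le u(x,t)\le s_2\quad\text{for a.e. } x\in\Omega.$$
   Context: $\Omega\subset\mathbb{R}^N$ ($N\ge1$) is a (nonempty) bounded open set, $|A|$ is the Lebesgue measure of $A$, and $\langle g\rangle:=\frac1{|\Omega|}\int_\Omega g\,dx$. The function $f:\mathbb{R}\to\mathbb{R}$ satisfies the following. $f\in C^1(\mathbb{R})$ and there are $m<M$ with $f'(m)=f'(M)=0$, $f'<0$ on $(-\infty,m)\cup(M,\infty)$, $f'>0$ on $(m,M)$; and there are $s_*<s^*$ with $s_*<m<M<s^*$, $f(s_* )=f(M)$, $f(s^* )=f(m)$. Problem $(P)$: $u_t=f(u)-\langle f(u)\rangle$ for $t>0$, $u(0)=u_0$, viewed as an ordinary differential equation in $L^\infty(\Omega)$: a solution on $[0,T)$ is a function $u\in C^1([0,T);L^\infty(\Omega))$ with $u(0)=u_0$ and $\frac{du}{dt}=f(u)-\langle f(u)\rangle$. One writes $u(x,t)$ for the value of $u(t)\in L^\infty(\Omega)$ at $x$. *)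

theory Defs
  imports "HOL-Analysis.Analysis" "HOL-Probability.Essential_Supremum"
begin

text \<open>The elements of \<open>L\<^sup>\<infinity>\<close> are represented by functions, the equality of \<open>L\<^sup>\<infinity>\<close> being equality
  almost everywhere. The library's \<^const>\<open>esssup\<close> takes the value \<open>-\<infinity>\<close> on null measure spaces, so
  \<open>Linf_norm\<close> is a norm only when the measure is nonzero.\<close>

definition Linf_norm :: "'a measure \<Rightarrow> ('a \<Rightarrow> real) \<Rightarrow> ereal" where
  "Linf_norm \<mu> g = esssup \<mu> (\<lambda>x. ereal \<bar>g x\<bar>)"

definition Linf :: "'a measure \<Rightarrow> ('a \<Rightarrow> real) set" where
  "Linf \<mu> = {g \<in> borel_measurable \<mu>. Linf_norm \<mu> g < \<infinity>}"

definition has_Linf_derivative ::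
  "'a measure \<Rightarrow> (real \<Rightarrow> 'a \<Rightarrow> real) \<Rightarrow> ('a \<Rightarrow> real) \<Rightarrow> real \<Rightarrow> real set \<Rightarrow> bool" where
  "has_Linf_derivative \<mu> u v t I \<longleftrightarrow>
     ((\<lambda>s. Linf_norm \<mu> (\<lambda>x. (u s x - u t x) / (s - t) - v x)) \<longlongrightarrow> 0) (at t within I)"

definition continuous_on_Linf :: "'a measure \<Rightarrow> real set \<Rightarrow> (real \<Rightarrow> 'a \<Rightarrow> real) \<Rightarrow> bool" where
  "continuous_on_Linf \<mu> I u \<longleftrightarrow>
     (\<forall>t\<in>I. ((\<lambda>s. Linf_norm \<mu> (\<lambda>x. u s x - u t x)) \<longlongrightarrow> 0) (at t within I))"

text \<open>\<open>u \<in> C\<^sup>1(I; L\<^sup>\<infinity>)\<close> with derivative \<open>u'\<close>; the derivative is one-sided at endpoints of \<open>I\<close>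
  belonging to \<open>I\<close>.\<close>

definition C1_Linf_with_derivative ::
  "'a measure \<Rightarrow> real set \<Rightarrow> (real \<Rightarrow> 'a \<Rightarrow> real) \<Rightarrow> (real \<Rightarrow> 'a \<Rightarrow> real) \<Rightarrow> bool" where
  "C1_Linf_with_derivative \<mu> I u u' \<longleftrightarrow>
     (\<forall>t\<in>I. u t \<in> Linf \<mu> \<and> u' t \<in> Linf \<mu> \<and> has_Linf_derivative \<mu> u (u' t) t I) \<and>
     continuous_on_Linf \<mu> I u'"

definition average :: "'a::euclidean_space set \<Rightarrow> ('a \<Rightarrow> real) \<Rightarrow> real" where
  "average \<Omega> g = 1 / measure lebesgue \<Omega> * (LINT x|lebesgue_on \<Omega>. g x)"

text \<open>Solutions of Problem \<open>(P)\<close> on the time interval \<open>I\<close>, which is meant to be \<open>{0..<T}\<close>, or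
  \<open>{0..}\<close> for time-global solutions.\<close>

definition solution_P ::
  "'a::euclidean_space set \<Rightarrow> (real \<Rightarrow> real) \<Rightarrow> ('a \<Rightarrow> real) \<Rightarrow> real set \<Rightarrow> (real \<Rightarrow> 'a \<Rightarrow> real) \<Rightarrow> bool" where
  "solution_P \<Omega> f u0 I u \<longleftrightarrow>
     (\<exists>u'. C1_Linf_with_derivative (lebesgue_on \<Omega>) I u u' \<and>
        (\<forall>t\<in>I. AE x in lebesgue_on \<Omega>. u' t x = f (u t x) - average \<Omega> (\<lambda>y. f (u t y)))) \<and>
     (AE x in lebesgue_on \<Omega>. u 0 x = u0 x)"

end

theory Submission
  imports Defs
begin

text \<open>The right-hand side is spatially coupled only through the scalar \<open>\<langle>f(u)\<rangle>\<close>, so points with the same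
  initial value move together: \<open>u(x,t) = Y(t)(u\<^sub>0(x))\<close> for a curve \<open>Y\<close> in the Banach space of bounded
  continuous functions on the line. The shape of \<open>f\<close> and the position of \<open>s\<^sub>1\<close>, \<open>s\<^sub>2\<close> give
  \<open>f(s\<^sub>2) \<le> f \<le> f(s\<^sub>1)\<close> on \<open>[s\<^sub>1,s\<^sub>2]\<close>, hence \<open>f(s\<^sub>2) \<le> \<langle>f(u)\<rangle> \<le> f(s\<^sub>1)\<close>, and an explicit Euler step
  that is small compared with the Lipschitz constant of \<open>f\<close> maps \<open>[s\<^sub>1,s\<^sub>2]\<close>-valued functions to
  \<open>[s\<^sub>1,s\<^sub>2]\<close>-valued ones. The limit of the Euler polygons is therefore a global solution with the
  asserted bounds. Any solution conserves its integral, as \<open>f(u) - \<langle>f(u)\<rangle>\<close> has mean zero; for the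
  difference \<open>d\<close> of two solutions the nonlocal term thus drops out of the derivative of \<open>\<integral>d\<^sup>2\<close>, and
  a Gronwall argument gives uniqueness.\<close>

section \<open>Euler's method on an invariant closed set\<close>

text \<open>Invariance is required of the explicit Euler step, not of the exact flow: by
  \<open>step_in_K\<close> all iterates with step at most \<open>h0\<close> remain in
  \<open>K\<close>, so a Lipschitz constant and a bound valid on \<open>K\<close> control every time
  interval, and no blow-up has to be excluded.\<close>

locale invariant_euler_scheme =
  fixes K :: "'a::banach set" and F :: "'a \<Rightarrow> 'a" and L B h0 :: real
  assumes closed_K: "closed K"
    and lipschitz: "L-lipschitz_on K F"
    and F_bound: "\<And>y. y \<in> K \<Longrightarrow> norm (F y) \<le> B"
    and h0_pos: "0 < h0"
    and step_in_K: "\<And>y h. y \<in> K \<Longrightarrow> 0 \<le> h \<Longrightarrow> h \<le> h0 \<Longrightarrow> y + h *\<^sub>R F y \<in> K"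
begin

section \<open>Euler iterates with a fixed step\<close>

definition euler :: "real \<Rightarrow> nat \<Rightarrow> 'a \<Rightarrow> 'a" where
  "euler h n = ((\<lambda>y. y + h *\<^sub>R F y) ^^ n)"

lemma euler_0 [simp]: "euler h 0 y = y"
  and euler_Suc: "euler h (Suc n) y = euler h n y + h *\<^sub>R F (euler h n y)"
  by (simp_all add: euler_def)

lemma euler_add: "euler h (i + n) y = euler h n (euler h i y)"
  by (simp add: euler_def add.commute[of i] funpow_add)

lemma euler_in_K:
  assumes "y \<in> K" "0 \<le> h" "h \<le> h0"
  shows "euler h n y \<in> K"
  by (induction n) (auto simp: euler_Suc assms step_in_K)

lemma L_nonneg: "0 \<le> L"
  using lipschitz by (rule lipschitz_on_nonneg)

lemma lip: "x \<in> K \<Longrightarrow> y \<in> K \<Longrightarrow> norm (F x - F y) \<le> L * norm (x - y)"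
  using lipschitz by (metis dist_norm lipschitz_onD)

lemma B_nonneg: "y \<in> K \<Longrightarrow> 0 \<le> B"
  using F_bound norm_ge_zero order_trans by blast

lemma euler_dist:
  assumes "y \<in> K" "0 \<le> h" "h \<le> h0"
  shows "norm (euler h n y - y) \<le> B * (real n * h)"
proof (induction n)
  case (Suc n)
  have "norm (euler h (Suc n) y - y) \<le> norm (euler h n y - y) + norm (h *\<^sub>R F (euler h n y))"
    by (metis add_diff_eq add.commute diff_add_eq euler_Suc norm_triangle_ineq)
  also have "norm (h *\<^sub>R F (euler h n y)) \<le> h * B"
    using assms F_bound[OF euler_in_K[OF assms]] by (simp add: mult_left_mono)
  finally show ?case
    using Suc by (simp add: algebra_simps)
qed simp

text \<open>Each of the \<open>n\<close> increments evaluates \<open>F\<close> within distance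
  \<open>B * (real n * h)\<close> of \<open>y\<close>, hence deviates from
  \<open>h *\<^sub>R F y\<close> by at most \<open>h * (L * (B * (real n * h)))\<close>. The bound
  involves only the elapsed time \<open>real n * h\<close>, so it survives the limit of vanishing
  step and there yields the derivative.\<close>

lemma euler_linearization:
  assumes "y \<in> K" "0 \<le> h" "h \<le> h0"
  shows "norm (euler h n y - y - (real n * h) *\<^sub>R F y) \<le> L * B * (real n * h)\<^sup>2"
proof (induction n)
  case (Suc n)
  have "euler h (Suc n) y - y - (real (Suc n) * h) *\<^sub>R F y
      = (euler h n y - y - (real n * h) *\<^sub>R F y) + h *\<^sub>R (F (euler h n y) - F y)"
    by (simp add: euler_Suc algebra_simps)
  then have "norm (euler h (Suc n) y - y - (real (Suc n) * h) *\<^sub>R F y)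
      \<le> norm (euler h n y - y - (real n * h) *\<^sub>R F y) + norm (h *\<^sub>R (F (euler h n y) - F y))"
    by (metis norm_triangle_ineq)
  also have "norm (h *\<^sub>R (F (euler h n y) - F y)) \<le> h * (L * (B * (real n * h)))"
    using lip[OF euler_in_K[OF assms] assms(1), of n] euler_dist[OF assms, of n] L_nonneg assms(2)
    by (smt (verit) mult_left_mono norm_scaleR)
  finally have "norm (euler h (Suc n) y - y - (real (Suc n) * h) *\<^sub>R F y)
      \<le> L * B * (real n * h)\<^sup>2 + h * (L * (B * (real n * h)))"
    using Suc by simp
  also have "\<dots> = L * B * (h\<^sup>2 * (real n * real n + real n))"
    by (simp add: algebra_simps power2_eq_square)
  also have "\<dots> \<le> L * B * (h\<^sup>2 * (real (Suc n))\<^sup>2)"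
    using L_nonneg B_nonneg[OF assms(1)]
    by (intro mult_left_mono) (auto simp: power2_eq_square algebra_simps)
  also have "\<dots> = L * B * (real (Suc n) * h)\<^sup>2"
    by (simp add: power_mult_distrib)
  finally show ?case .
qed simp

text \<open>Two half steps differ from one full step by at most \<open>L B h\<^sup>2/4\<close>, and one step expands distances by
  at most the factor \<open>1 + L h\<close>; the accumulated error is a geometric sum.\<close>

lemma euler_halve_step:
  assumes y: "y \<in> K" and h: "0 \<le> h" "h \<le> h0"
  shows "norm (euler h n y - euler (h/2) (2 * n) y) \<le> B * h * (exp (L * h * real n) - 1)"
proof (induction n)
  case (Suc n)
  let ?x = "euler h n y" and ?z = "euler (h/2) (2 * n) y"
  let ?z' = "?z + (h/2) *\<^sub>R F ?z"
  have K: "?x \<in> K" "?z \<in> K" "?z' \<in> K"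
    using y h by (auto intro!: euler_in_K step_in_K)
  have *: "norm (F ?z - F ?z') \<le> L * (h/2 * B)"
  proof -
    have "norm (F ?z - F ?z') \<le> L * norm (?z - ?z')"
      using K by (intro lip)
    also have "norm (?z - ?z') \<le> h/2 * B"
      using h F_bound[OF K(2)] by (simp add: mult_left_mono)
    finally show ?thesis
      using L_nonneg by (simp add: mult_left_mono)
  qed
  \<comment> \<open>The three terms are the old error, its growth over one full step, and the defect
    between one full step and two half steps started at \<open>?z\<close>.\<close>
  have split: "euler h (Suc n) y - euler (h/2) (2 * Suc n) y
      = (?x - ?z) + h *\<^sub>R (F ?x - F ?z) + (h/2) *\<^sub>R (F ?z - F ?z')"
    by (simp add: euler_Suc algebra_simps flip: scaleR_2)
  have "norm (euler h (Suc n) y - euler (h/2) (2 * Suc n) y)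
      \<le> norm (?x - ?z) + norm (h *\<^sub>R (F ?x - F ?z)) + norm ((h/2) *\<^sub>R (F ?z - F ?z'))"
    unfolding split by (meson add_right_mono norm_triangle_ineq order_trans)
  also have "\<dots> \<le> norm (?x - ?z) + h * (L * norm (?x - ?z)) + h/2 * (L * (h/2 * B))"
    using h mult_left_mono[OF lip[OF K(1,2)] h(1)] mult_left_mono[OF *, of "h/2"] by simp
  also have "\<dots> = (1 + L * h) * norm (?x - ?z) + B * h * (L * h / 4)"
    by (simp add: algebra_simps)
  \<comment> \<open>Up to the common factor \<open>B * h\<close>, enlarging \<open>L * h / 4\<close>
    to \<open>L * h\<close> lets the new defect cancel the \<open>- L * h\<close> that the factor
    \<open>1 + L * h\<close> produces from \<open>- 1\<close>, so the bound keeps its form.\<close>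
  also have "\<dots> \<le> (1 + L * h) * (B * h * (exp (L * h * real n) - 1)) + B * h * (L * h)"
    using Suc L_nonneg h B_nonneg[OF y] by (intro add_mono mult_left_mono) auto
  also have "\<dots> = B * h * ((1 + L * h) * exp (L * h * real n) - 1)"
    by (simp add: algebra_simps)
  also have "\<dots> \<le> B * h * (exp (L * h) * exp (L * h * real n) - 1)"
    using h B_nonneg[OF y] exp_ge_add_one_self[of "L * h"]
    by (intro mult_left_mono diff_right_mono mult_right_mono) auto
  also have "\<dots> = B * h * (exp (L * h * real (Suc n)) - 1)"
    by (simp add: algebra_simps flip: exp_add)
  finally show ?case .
qed simp

section \<open>Approximation along dyadic steps\<close>

definition mesh :: "nat \<Rightarrow> real" where
  "mesh k = h0 / 2 ^ k"

definition steps :: "nat \<Rightarrow> real \<Rightarrow> nat" where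
  "steps k t = nat \<lfloor>t / mesh k\<rfloor>"

text \<open>Constant between grid points rather than interpolated, so that each value is itself an
  Euler iterate and lies in \<open>K\<close> when \<open>y\<close> does.\<close>

definition approx :: "'a \<Rightarrow> nat \<Rightarrow> real \<Rightarrow> 'a" where
  "approx y k t = euler (mesh k) (steps k t) y"

lemma mesh: "0 < mesh k" "mesh k \<le> h0" "mesh (Suc k) = mesh k / 2"
  using h0_pos by (simp_all add: mesh_def field_simps)

lemma steps_bounds:
  assumes "0 \<le> t"
  shows "real (steps k t) * mesh k \<le> t" "t < real (steps k t) * mesh k + mesh k"
proof -
  have n: "real (steps k t) = of_int \<lfloor>t / mesh k\<rfloor>"
    using assms mesh(1)[of k] by (simp add: steps_def)
  show "real (steps k t) * mesh k \<le> t"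
    unfolding n using mesh(1)[of k] by (metis floor_divide_lower)
  show "t < real (steps k t) * mesh k + mesh k"
    unfolding n using floor_divide_upper[OF mesh(1), of t k] by (simp add: algebra_simps)
qed

lemma steps_mono: "s \<le> t \<Longrightarrow> steps k s \<le> steps k t"
  using mesh(1)[of k] by (auto simp: steps_def intro!: nat_mono floor_mono divide_right_mono)

lemma steps_tendsto:
  assumes "0 \<le> t"
  shows "(\<lambda>k. real (steps k t) * mesh k) \<longlonglongrightarrow> t"
proof (rule tendsto_sandwich[where f="\<lambda>k. t - mesh k" and h="\<lambda>_. t"])
  have "(\<lambda>k. t - h0 * (1/2) ^ k) \<longlonglongrightarrow> t - h0 * 0"
    by (intro tendsto_intros LIMSEQ_realpow_zero) auto
  then show "(\<lambda>k. t - mesh k) \<longlonglongrightarrow> t"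
    by (simp add: mesh_def power_divide)
qed (use steps_bounds[OF assms] in \<open>auto intro!: always_eventually simp: less_imp_le algebra_simps\<close>)

text \<open>Halving the mesh keeps all old grid points, so the last grid point up to
  \<open>t\<close> either stays or advances by one half step.\<close>

lemma steps_Suc:
  assumes "0 \<le> t"
  shows "steps (Suc k) t = 2 * steps k t \<or> steps (Suc k) t = Suc (2 * steps k t)"
proof -
  let ?n = "steps k t" and ?m = "steps (Suc k) t" and ?h = "mesh (Suc k)"
  have "real ?m * ?h < (2 * real ?n + 2) * ?h" "2 * real ?n * ?h < (real ?m + 1) * ?h"
    using steps_bounds[OF assms, of k] steps_bounds[OF assms, of "Suc k"]
    by (simp_all add: mesh(3) algebra_simps)
  then have "real ?m < 2 * real ?n + 2" "2 * real ?n < real ?m + 1"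
    using mesh(1)[of "Suc k"] by (simp_all only: mult_less_cancel_right_pos)
  then show ?thesis by linarith
qed

lemma approx_in_K: "y \<in> K \<Longrightarrow> approx y k t \<in> K"
  unfolding approx_def using mesh by (intro euler_in_K) (auto simp: less_imp_le)

text \<open>The possible extra half step costs at most \<open>B * mesh k\<close>, and
  \<open>2 * steps k t\<close> half steps are compared with \<open>steps k t\<close> full ones by
  \<open>euler_halve_step\<close>; the \<open>- 1\<close> there absorbs the former cost. The factor
  \<open>mesh k\<close> makes the bound geometric in \<open>k\<close>.\<close>

lemma approx_Suc_dist:
  assumes "y \<in> K" "0 \<le> t"
  shows "norm (approx y (Suc k) t - approx y k t) \<le> B * exp (L * t) * mesh k"
proof -
  let ?n = "steps k t" and ?h = "mesh k"
  note h = less_imp_le[OF mesh(1)] mesh(2)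
  have "norm (euler (?h/2) (steps (Suc k) t) y - euler (?h/2) (2 * ?n) y) \<le> B * ?h"
  proof (cases "steps (Suc k) t = 2 * ?n")
    case False
    then have "norm (euler (?h/2) (steps (Suc k) t) y - euler (?h/2) (2 * ?n) y)
        = ?h/2 * norm (F (euler (?h/2) (2 * ?n) y))"
      using steps_Suc[OF assms(2), of k] h(1)[of k] by (simp add: euler_Suc)
    also have "\<dots> \<le> ?h * B"
      using h[of "Suc k"] h(1)[of k] F_bound[OF euler_in_K[OF assms(1)], of "?h/2" "2 * ?n"]
      by (intro mult_mono) (auto simp: mesh(3))
    finally show ?thesis by (simp add: mult.commute)
  qed (use h(1)[of k] B_nonneg[OF assms(1)] in auto)
  moreover have "norm (euler ?h ?n y - euler (?h/2) (2 * ?n) y) \<le> B * ?h * (exp (L * t) - 1)"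
  proof -
    have "L * ?h * real ?n \<le> L * t"
      using steps_bounds(1)[OF assms(2), of k] L_nonneg
      by (metis mult.assoc mult.commute mult_left_mono)
    then have "B * ?h * (exp (L * ?h * real ?n) - 1) \<le> B * ?h * (exp (L * t) - 1)"
      using B_nonneg[OF assms(1)] h(1)[of k] by (intro mult_left_mono) auto
    then show ?thesis
      using euler_halve_step[OF assms(1) h, of k ?n] by linarith
  qed
  moreover have "norm (approx y (Suc k) t - approx y k t)
      \<le> norm (euler (?h/2) (steps (Suc k) t) y - euler (?h/2) (2 * ?n) y)
        + norm (euler ?h ?n y - euler (?h/2) (2 * ?n) y)"
    using norm_triangle_ineq4[of "euler (?h/2) (steps (Suc k) t) y - euler (?h/2) (2 * ?n) y"
        "euler ?h ?n y - euler (?h/2) (2 * ?n) y"]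
    by (simp add: approx_def mesh(3))
  ultimately have "norm (approx y (Suc k) t - approx y k t) \<le> B * ?h + B * ?h * (exp (L * t) - 1)"
    by linarith
  also have "\<dots> = B * exp (L * t) * ?h"
    by (simp add: algebra_simps)
  finally show ?thesis .
qed

text \<open>The increments in \<open>k\<close> are dominated by a geometric series, so the
  telescoping series converges absolutely; completeness of the space enters here.\<close>

lemma approx_convergent:
  assumes "y \<in> K" "0 \<le> t"
  shows "convergent (\<lambda>k. approx y k t)"
proof -
  have "summable (\<lambda>k. B * exp (L * t) * h0 * (1/2) ^ k)"
    by (intro summable_mult summable_geometric) auto
  then have "summable (\<lambda>k. approx y (Suc k) t - approx y k t)"
  proof (rule summable_comparison_test'[where N=0])
    show "norm (approx y (Suc k) t - approx y k t) \<le> B * exp (L * t) * h0 * (1/2) ^ k" for k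
      using approx_Suc_dist[OF assms, of k] by (simp add: mesh_def power_divide)
  qed
  then have "convergent (\<lambda>n. \<Sum>k<n. approx y (Suc k) t - approx y k t)"
    by (simp add: summable_iff_convergent)
  then have "convergent (\<lambda>n. approx y n t - approx y 0 t)"
    by (simp only: sum_lessThan_telescope[of "\<lambda>k. approx y k t"])
  then have "convergent (\<lambda>n. (approx y n t - approx y 0 t) + approx y 0 t)"
    by (intro convergent_add convergent_const)
  then show ?thesis
    by simp
qed

section \<open>The limit flow and its differential equation\<close>

definition flow :: "'a \<Rightarrow> real \<Rightarrow> 'a" where
  "flow y t = lim (\<lambda>k. approx y k t)"

context
  fixes y assumes y: "y \<in> K"
begin

lemma flow_tendsto: "0 \<le> t \<Longrightarrow> (\<lambda>k. approx y k t) \<longlonglongrightarrow> flow y t"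
  unfolding flow_def using approx_convergent[OF y] by (simp add: convergent_LIMSEQ_iff)

lemma flow_in_K: "0 \<le> t \<Longrightarrow> flow y t \<in> K"
  by (rule closed_sequentially[OF closed_K _ flow_tendsto]) (simp_all add: approx_in_K[OF y])

lemma flow_0: "flow y 0 = y"
  by (simp add: flow_def approx_def steps_def)

text \<open>\<open>euler_linearization\<close>, applied from the last grid point up to
  \<open>t\<close> to the last one up to \<open>s\<close>, has constants independent of
  \<open>k\<close>; the grid time \<open>\<tau> k\<close> between them tends to
  \<open>s - t\<close>, and \<open>F\<close> is continuous on \<open>K\<close>.\<close>

lemma flow_linearization:
  assumes "0 \<le> t" "t \<le> s"
  shows "norm (flow y s - flow y t - (s - t) *\<^sub>R F (flow y t)) \<le> L * B * (s - t)\<^sup>2"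
proof -
  define \<tau> where "\<tau> k = real (steps k s) * mesh k - real (steps k t) * mesh k" for k
  have \<tau>: "\<tau> \<longlonglongrightarrow> s - t"
    unfolding \<tau>_def using assms by (intro tendsto_diff steps_tendsto) auto
  have F: "(\<lambda>k. F (approx y k t)) \<longlonglongrightarrow> F (flow y t)"
    by (rule continuous_on_tendsto_compose[OF lipschitz_on_continuous_on[OF lipschitz] flow_tendsto])
      (use assms approx_in_K[OF y] flow_in_K in auto)
  have le: "norm (approx y k s - approx y k t - \<tau> k *\<^sub>R F (approx y k t)) \<le> L * B * (\<tau> k)\<^sup>2" for k
  proof -
    define n where "n = steps k s - steps k t"
    have n: "steps k s = steps k t + n"
      using steps_mono[OF assms(2), of k] by (simp add: n_def)
    have "\<tau> k = real n * mesh k"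
      by (simp add: \<tau>_def n algebra_simps)
    moreover have "approx y k s = euler (mesh k) n (approx y k t)"
      by (simp add: approx_def n euler_add)
    ultimately show ?thesis
      using euler_linearization[OF approx_in_K[OF y], of "mesh k"] mesh[of k] by simp
  qed
  have lhs: "(\<lambda>k. norm (approx y k s - approx y k t - \<tau> k *\<^sub>R F (approx y k t)))
      \<longlonglongrightarrow> norm (flow y s - flow y t - (s - t) *\<^sub>R F (flow y t))"
    using assms by (intro tendsto_intros flow_tendsto \<tau> F) auto
  have rhs: "(\<lambda>k. L * B * (\<tau> k)\<^sup>2) \<longlonglongrightarrow> L * B * (s - t)\<^sup>2"
    by (intro tendsto_intros \<tau>)
  show ?thesis
    using le by (intro LIMSEQ_le[OF lhs rhs]) auto
qed

text \<open>The limit of \<open>euler_dist\<close>. It serves to change the base point of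
  \<open>F\<close> in backward difference quotients.\<close>

lemma flow_lipschitz:
  assumes "0 \<le> t" "0 \<le> s"
  shows "norm (flow y s - flow y t) \<le> B * \<bar>s - t\<bar>"
proof -
  have *: "norm (flow y s - flow y t) \<le> B * (s - t)" if "0 \<le> t" "t \<le> s" for s t
  proof -
    have le: "norm (approx y k s - approx y k t) \<le> B * (real (steps k s) * mesh k - real (steps k t) * mesh k)" for k
    proof -
      define n where "n = steps k s - steps k t"
      have n: "steps k s = steps k t + n"
        using steps_mono[OF that(2), of k] by (simp add: n_def)
      have "approx y k s = euler (mesh k) n (approx y k t)"
        by (simp add: approx_def n euler_add)
      then show ?thesis
        using euler_dist[OF approx_in_K[OF y], of "mesh k" n k t] mesh[of k]
        by (simp add: n algebra_simps)
    qed
    have lhs: "(\<lambda>k. norm (approx y k s - approx y k t)) \<longlonglongrightarrow> norm (flow y s - flow y t)"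
      using that by (intro tendsto_intros flow_tendsto) auto
    have rhs: "(\<lambda>k. B * (real (steps k s) * mesh k - real (steps k t) * mesh k)) \<longlonglongrightarrow> B * (s - t)"
      using that by (intro tendsto_intros steps_tendsto) auto
    show ?thesis
      using le by (intro LIMSEQ_le[OF lhs rhs]) auto
  qed
  show ?thesis
    using *[of t s] *[of s t] assms by (cases "t \<le> s") (auto simp: norm_minus_commute)
qed

lemma flow_has_vector_derivative:
  assumes t: "0 \<le> t"
  shows "(flow y has_vector_derivative F (flow y t)) (at t within {0..})"
proof -
  have bound: "norm (flow y s - flow y t - (s - t) *\<^sub>R F (flow y t)) \<le> 2 * L * B * (s - t)\<^sup>2"
    if s: "0 \<le> s" for s
  proof (cases "t \<le> s")
    case True
    moreover have "0 \<le> L * B * (s - t)\<^sup>2"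
      using L_nonneg B_nonneg[OF y] by simp
    ultimately show ?thesis
      using flow_linearization[OF t, of s] by linarith
  next
    case False
    \<comment> \<open>For \<open>s < t\<close> the linearization is available only with the earlier
      time \<open>s\<close> as base point; exchanging \<open>F (flow y s)\<close> for
      \<open>F (flow y t)\<close> costs a second \<open>L * B * (s - t)\<^sup>2\<close>, whence the
      factor 2.\<close>
    have split: "flow y s - flow y t - (s - t) *\<^sub>R F (flow y t)
        = (t - s) *\<^sub>R (F (flow y t) - F (flow y s)) - (flow y t - flow y s - (t - s) *\<^sub>R F (flow y s))"
      by (simp add: algebra_simps)
    have "norm (flow y s - flow y t - (s - t) *\<^sub>R F (flow y t))
        \<le> norm ((t - s) *\<^sub>R (F (flow y t) - F (flow y s)))
          + norm (flow y t - flow y s - (t - s) *\<^sub>R F (flow y s))"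
      unfolding split by (rule norm_triangle_ineq4)
    also have "\<dots> \<le> (t - s) * (L * (B * (t - s))) + L * B * (t - s)\<^sup>2"
    proof (intro add_mono)
      have "norm (F (flow y t) - F (flow y s)) \<le> L * (B * (t - s))"
        using lip[OF flow_in_K[OF t] flow_in_K[OF s]] flow_lipschitz[OF s t] L_nonneg False
        by (smt (verit) mult_left_mono)
      then show "norm ((t - s) *\<^sub>R (F (flow y t) - F (flow y s))) \<le> (t - s) * (L * (B * (t - s)))"
        using False by (simp add: mult_left_mono)
    qed (use flow_linearization[OF s, of t] False in auto)
    also have "\<dots> = 2 * L * B * (s - t)\<^sup>2"
      by (simp add: power2_eq_square algebra_simps)
    finally show ?thesis .
  qed
  show ?thesis
    unfolding has_vector_derivative_def
  proof (rule has_derivativeI_sandwich[where e=1 and H="\<lambda>s. 2 * L * B * \<bar>s - t\<bar>"])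
    have "((\<lambda>s. 2 * L * B * \<bar>s - t\<bar>) \<longlongrightarrow> 2 * L * B * \<bar>t - t\<bar>) (at t within {0..})"
      by (intro tendsto_intros)
    then show "((\<lambda>s. 2 * L * B * \<bar>s - t\<bar>) \<longlongrightarrow> 0) (at t within {0..})"
      by simp
    fix s :: real assume "s \<in> {0..}" "s \<noteq> t" "dist s t < 1"
    then show "norm (flow y s - flow y t - (s - t) *\<^sub>R F (flow y t)) / norm (s - t) \<le> 2 * L * B * \<bar>s - t\<bar>"
      using bound[of s] by (simp add: divide_le_eq power2_eq_square abs_mult[symmetric] flip: mult.assoc)
  qed (auto intro!: bounded_linear_intros)
qed

end

end

section \<open>Functions and derivatives in the space of essentially bounded functions\<close>

lemma esssup_less_imp_AE: "esssup M g < c \<Longrightarrow> AE x in M. g x \<le> c"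
  using esssup_AE[of g M] by (auto elim: eventually_mono)

lemma Linf_norm_leI:
  assumes "g \<in> borel_measurable M" "AE x in M. \<bar>g x\<bar> \<le> c"
  shows "Linf_norm M g \<le> ereal c"
  unfolding Linf_norm_def using assms by (intro esssup_I) auto

text \<open>The lower half of the sandwich in \<open>Linf_norm_tendsto_0I\<close>. The condition on
  \<open>M\<close> rules out the value minus infinity.\<close>

lemma Linf_norm_nonneg:
  assumes "emeasure M (space M) \<noteq> 0" "g \<in> borel_measurable M"
  shows "0 \<le> Linf_norm M g"
  unfolding Linf_norm_def
  using esssup_mono[of "\<lambda>_. 0 :: ereal" M "\<lambda>x. ereal \<bar>g x\<bar>"] assms
  by (simp add: esssup_const)

lemma LinfI:
  assumes "g \<in> borel_measurable M" "AE x in M. \<bar>g x\<bar> \<le> c"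
  shows "g \<in> Linf M"
  using Linf_norm_leI[OF assms] assms(1) by (auto simp: Linf_def intro: le_less_trans)

lemma Linf_measurable: "g \<in> Linf M \<Longrightarrow> g \<in> borel_measurable M"
  by (simp add: Linf_def)

lemma Linf_bounded:
  assumes "g \<in> Linf M"
  obtains c where "0 \<le> c" "AE x in M. \<bar>g x\<bar> \<le> c"
proof -
  obtain r where "Linf_norm M g < ereal r"
    using assms less_PInf_Ex_of_nat[of "Linf_norm M g"] by (auto simp: Linf_def)
  then have "AE x in M. ereal \<bar>g x\<bar> \<le> ereal r"
    unfolding Linf_norm_def by (rule esssup_less_imp_AE)
  then have "AE x in M. \<bar>g x\<bar> \<le> max 0 r"
    by eventually_elim auto
  then show ?thesis
    using that[of "max 0 r"] by simp
qed

lemma Linf_diff: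
  assumes g: "g \<in> Linf M" and h: "h \<in> Linf M"
  shows "(\<lambda>x. g x - h x) \<in> Linf M"
proof -
  note [measurable] = Linf_measurable[OF g] Linf_measurable[OF h]
  obtain a where a: "AE x in M. \<bar>g x\<bar> \<le> a"
    using Linf_bounded[OF g] .
  obtain b where b: "AE x in M. \<bar>h x\<bar> \<le> b"
    using Linf_bounded[OF h] .
  from a b have "AE x in M. \<bar>g x - h x\<bar> \<le> a + b"
    by eventually_elim linarith
  then show ?thesis
    by (intro LinfI) auto
qed

lemma Linf_mult:
  assumes g: "g \<in> Linf M" and h: "h \<in> Linf M"
  shows "(\<lambda>x. g x * h x) \<in> Linf M"
proof -
  note [measurable] = Linf_measurable[OF g] Linf_measurable[OF h]
  obtain a where a: "0 \<le> a" "AE x in M. \<bar>g x\<bar> \<le> a"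
    using Linf_bounded[OF g] .
  obtain b where b: "0 \<le> b" "AE x in M. \<bar>h x\<bar> \<le> b"
    using Linf_bounded[OF h] .
  from a(2) b(2) have "AE x in M. \<bar>g x * h x\<bar> \<le> a * b"
    by eventually_elim (auto simp: abs_mult intro!: mult_mono a(1))
  then show ?thesis
    by (intro LinfI) auto
qed

lemma (in finite_measure) integrable_Linf: "g \<in> Linf M \<Longrightarrow> integrable M g"
  by (rule Linf_bounded, assumption)
    (rule integrable_const_bound, auto simp: Linf_measurable)

section \<open>Limits and derivatives for essentially bounded functions\<close>

lemma Linf_norm_tendsto_0_imp_AE:
  assumes "((\<lambda>s. Linf_norm M (G s)) \<longlongrightarrow> 0) A" "0 < e"
  shows "\<forall>\<^sub>F s in A. AE x in M. \<bar>G s x\<bar> \<le> e"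
proof -
  have "\<forall>\<^sub>F s in A. Linf_norm M (G s) < ereal e"
    using assms by (intro order_tendstoD(2)) auto
  then show ?thesis
  proof eventually_elim
    case (elim s)
    then have "AE x in M. ereal \<bar>G s x\<bar> \<le> ereal e"
      unfolding Linf_norm_def by (rule esssup_less_imp_AE)
    then show ?case by simp
  qed
qed

lemma Linf_norm_tendsto_0I:
  assumes "emeasure M (space M) \<noteq> 0" "\<And>s. G s \<in> borel_measurable M"
    and "\<forall>\<^sub>F s in A. \<forall>x. \<bar>G s x\<bar> \<le> H s" "(H \<longlongrightarrow> 0) A"
  shows "((\<lambda>s. Linf_norm M (G s)) \<longlongrightarrow> 0) A"
proof (rule tendsto_sandwich[where f="\<lambda>_. 0" and h="\<lambda>s. ereal (H s)"])
  show "\<forall>\<^sub>F s in A. Linf_norm M (G s) \<le> ereal (H s)"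
    using assms(3) by eventually_elim (rule Linf_norm_leI, auto simp: assms(2))
  show "((\<lambda>s. ereal (H s)) \<longlongrightarrow> 0) A"
    using assms(4) by (metis tendsto_ereal zero_ereal_def)
qed (simp_all add: Linf_norm_nonneg assms)

text \<open>What a derivative in \<open>L\<^sup>\<infinity>\<close> says about the a.e. size of difference quotients. Unlike \<^const>\<open>Linf_norm\<close>,
  this form needs no measurability when derivatives are combined.\<close>

definition AE_derivative ::
  "'a measure \<Rightarrow> (real \<Rightarrow> 'a \<Rightarrow> real) \<Rightarrow> ('a \<Rightarrow> real) \<Rightarrow> real filter \<Rightarrow> real \<Rightarrow> bool" where
  "AE_derivative M u u' A t \<longleftrightarrow>
     (\<forall>e>0. \<forall>\<^sub>F s in A. AE x in M. \<bar>(u s x - u t x) / (s - t) - u' x\<bar> \<le> e)"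

lemma AE_derivativeD:
  "AE_derivative M u u' A t \<Longrightarrow> 0 < e \<Longrightarrow>
     \<forall>\<^sub>F s in A. AE x in M. \<bar>(u s x - u t x) / (s - t) - u' x\<bar> \<le> e"
  by (simp add: AE_derivative_def)

lemma has_Linf_derivative_imp_AE_derivative:
  "has_Linf_derivative M u u' t I \<Longrightarrow> AE_derivative M u u' (at t within I) t"
  unfolding has_Linf_derivative_def AE_derivative_def
  by (auto intro: Linf_norm_tendsto_0_imp_AE[where G="\<lambda>s x. (u s x - u t x) / (s - t) - u' x"])

lemma AE_derivative_diff:
  assumes "AE_derivative M u u' A t" "AE_derivative M v v' A t"
  shows "AE_derivative M (\<lambda>s x. u s x - v s x) (\<lambda>x. u' x - v' x) A t"
  unfolding AE_derivative_def
proof safe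
  fix e :: real assume "0 < e"
  then have "0 < e/2" by simp
  from AE_derivativeD[OF assms(1) this] AE_derivativeD[OF assms(2) this]
  show "\<forall>\<^sub>F s in A. AE x in M. \<bar>(u s x - v s x - (u t x - v t x)) / (s - t) - (u' x - v' x)\<bar> \<le> e"
  proof eventually_elim
    case (elim s)
    then show ?case
    proof eventually_elim
      case (elim x)
      have "(u s x - v s x - (u t x - v t x)) / (s - t) - (u' x - v' x)
          = ((u s x - u t x) / (s - t) - u' x) - ((v s x - v t x) / (s - t) - v' x)"
        by (simp add: diff_divide_distrib)
      with elim show ?case by linarith
    qed
  qed
qed

text \<open>With \<open>q\<close> the difference quotient of \<open>d\<close>, that of the square is
  \<open>q * (2 * d t x + (s - t) * q)\<close>. The a.e. bounds on \<open>d t\<close> and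
  \<open>d'\<close> make every error term small uniformly in \<open>x\<close>.\<close>

lemma AE_derivative_square:
  assumes deriv: "AE_derivative M d d' (at t within I) t"
    and c: "0 \<le> c" "AE x in M. \<bar>d t x\<bar> \<le> c" "AE x in M. \<bar>d' x\<bar> \<le> c"
  shows "AE_derivative M (\<lambda>s x. (d s x)\<^sup>2) (\<lambda>x. 2 * (d t x * d' x)) (at t within I) t"
  unfolding AE_derivative_def
proof safe
  fix e :: real assume e: "0 < e"
  \<comment> \<open>\<open>C\<close> adds the coefficients of \<open>\<delta>\<close> in the bounds
    of the three summands of \<open>eq\<close>; \<open>\<delta> \<le> 1\<close> serves to bound
    \<open>\<bar>q\<bar>\<close> by \<open>c + 1\<close> and to keep the second summand linear in
    \<open>\<delta>\<close>.\<close>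
  define C where "C = 2 * c + (c + 1) + c * (c + 1)"
  define \<delta> where "\<delta> = min 1 (e / C)"
  have C: "0 < C"
    using c(1) by (simp add: C_def add_nonneg_pos add_pos_nonneg)
  then have \<delta>: "0 < \<delta>" "\<delta> \<le> 1" "\<delta> * C \<le> e"
    using e by (auto simp: \<delta>_def simp flip: pos_le_divide_eq)
  have "\<forall>\<^sub>F s in at t within I. \<bar>s - t\<bar> < \<delta> \<and> s \<noteq> t"
    using \<delta>(1) by (auto simp: eventually_at dist_real_def)
  with AE_derivativeD[OF deriv \<delta>(1)]
  show "\<forall>\<^sub>F s in at t within I. AE x in M. \<bar>((d s x)\<^sup>2 - (d t x)\<^sup>2) / (s - t) - 2 * (d t x * d' x)\<bar> \<le> e"
  proof eventually_elim
    case (elim s)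
    have s: "\<bar>s - t\<bar> \<le> \<delta>" "s \<noteq> t" using elim by auto
    from elim(1) c(2,3) show ?case
    proof eventually_elim
      case (elim x)
      define q where "q = (d s x - d t x) / (s - t)"
      have ds: "d s x = d t x + (s - t) * q"
        using s(2) by (simp add: q_def)
      have "(d s x)\<^sup>2 - (d t x)\<^sup>2 = q * (2 * d t x + (s - t) * q) * (s - t)"
        unfolding ds by (simp add: power2_eq_square algebra_simps)
      then have "((d s x)\<^sup>2 - (d t x)\<^sup>2) / (s - t) = q * (2 * d t x + (s - t) * q)"
        using s(2) by simp
      then have eq: "((d s x)\<^sup>2 - (d t x)\<^sup>2) / (s - t) - 2 * (d t x * d' x)
          = (q - d' x) * (2 * d t x) + (q - d' x) * ((s - t) * q) + d' x * ((s - t) * q)"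
        by (simp add: algebra_simps)
      have qd: "\<bar>q - d' x\<bar> \<le> \<delta>" using elim(1) by (simp add: q_def)
      then have q: "\<bar>q\<bar> \<le> c + 1" using elim(3) \<delta>(2) by linarith
      have sq: "\<bar>(s - t) * q\<bar> \<le> \<delta> * (c + 1)"
        using mult_mono[OF s(1) q] \<delta>(1) by (simp add: abs_mult)
      have "\<bar>(q - d' x) * (2 * d t x)\<bar> \<le> \<delta> * (2 * c)"
        unfolding abs_mult[of "q - d' x"] using elim(2) qd \<delta>(1) by (intro mult_mono) auto
      moreover have "\<bar>(q - d' x) * ((s - t) * q)\<bar> \<le> 1 * (\<delta> * (c + 1))"
        unfolding abs_mult[of "q - d' x"] using sq qd \<delta>(1,2) c(1) by (intro mult_mono) auto
      moreover have "\<bar>d' x * ((s - t) * q)\<bar> \<le> c * (\<delta> * (c + 1))"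
        unfolding abs_mult[of "d' x"] using sq elim(3) c(1) by (intro mult_mono) auto
      ultimately have "\<bar>((d s x)\<^sup>2 - (d t x)\<^sup>2) / (s - t) - 2 * (d t x * d' x)\<bar>
          \<le> \<delta> * (2 * c) + 1 * (\<delta> * (c + 1)) + c * (\<delta> * (c + 1))"
        unfolding eq by linarith
      also have "\<dots> = \<delta> * C"
        by (simp add: C_def algebra_simps)
      finally show ?case using \<delta>(3) by linarith
    qed
  qed
qed

text \<open>The difference quotients are close to \<open>u'\<close> uniformly outside null sets, so
  on a finite measure the error of the integral is at most
  \<open>\<delta> * measure M (space M)\<close>; no dominated convergence is involved.\<close>

lemma (in finite_measure) has_real_derivative_integral:
  assumes deriv: "AE_derivative M u u' (at t within I) t"
    and int: "\<And>s. s \<in> I \<Longrightarrow> integrable M (u s)" "integrable M u'" and t: "t \<in> I"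
  shows "((\<lambda>s. LINT x|M. u s x) has_real_derivative (LINT x|M. u' x)) (at t within I)"
  unfolding has_field_derivative_iff
proof (rule tendstoI)
  fix e :: real assume e: "0 < e"
  \<comment> \<open>Adding 1 keeps the denominator positive even if the total measure
    vanishes.\<close>
  define \<delta> where "\<delta> = e / (2 * (measure M (space M) + 1))"
  have pos: "0 < measure M (space M) + 1"
    by (simp add: add_nonneg_pos)
  then have \<delta>: "0 < \<delta>" using e by (simp add: \<delta>_def)
  have "\<delta> * measure M (space M) \<le> \<delta> * (measure M (space M) + 1)"
    using \<delta> by simp
  also have "\<dots> = e / 2"
    using pos by (simp add: \<delta>_def field_simps)
  finally have small: "\<delta> * measure M (space M) < e" using e by linarith
  have "\<forall>\<^sub>F s in at t within I. s \<in> I"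
    by (simp add: eventually_at_topological) blast
  with AE_derivativeD[OF deriv \<delta>]
  show "\<forall>\<^sub>F s in at t within I.
      dist (((LINT x|M. u s x) - (LINT x|M. u t x)) / (s - t)) (LINT x|M. u' x) < e"
  proof eventually_elim
    case (elim s)
    let ?g = "\<lambda>x. (u s x - u t x) / (s - t) - u' x"
    have g: "integrable M ?g"
      using int elim t by auto
    have "((LINT x|M. u s x) - (LINT x|M. u t x)) / (s - t) - (LINT x|M. u' x) = (LINT x|M. ?g x)"
      using int elim t by simp
    also have "\<bar>\<dots>\<bar> \<le> (LINT x|M. \<bar>?g x\<bar>)"
      by (rule integral_abs_bound)
    also have "\<dots> \<le> (LINT x|M. \<delta>)"
      using g elim(1) by (intro integral_mono_AE) auto
    also have "\<dots> < e"
      using small by (simp add: mult.commute)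
    finally show ?case by (simp add: dist_real_def)
  qed
qed

text \<open>The derivative at \<open>t\<close> bounds \<open>v\<close> on a neighbourhood of
  \<open>t\<close>, and bisection (\<open>Bolzano\<close>) glues such local bounds over a compact
  interval. The result confines solutions to an interval on which \<open>f\<close> is
  Lipschitz.\<close>

lemma C1_Linf_locally_bounded:
  assumes C1: "C1_Linf_with_derivative M {0..} v v'"
  obtains c where "0 \<le> c" "\<forall>t\<in>{0..T}. AE x in M. \<bar>v t x\<bar> \<le> c"
proof (cases "0 \<le> T")
  case True
  \<comment> \<open>The restriction \<open>0 \<le> t\<close> is built in because the small intervals
    around a point offered by \<open>Bolzano\<close> may extend below 0.\<close>
  define P where "P a b \<longleftrightarrow> (\<exists>c\<ge>0. \<forall>t. 0 \<le> t \<and> a \<le> t \<and> t \<le> b \<longrightarrow> (AE x in M. \<bar>v t x\<bar> \<le> c))"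
    for a b
  from True have "P 0 T"
  proof (induction rule: Bolzano)
    case (trans a b c)
    from trans(1) obtain c1 where "c1 \<ge> 0"
      and c1: "\<And>t. 0 \<le> t \<Longrightarrow> a \<le> t \<Longrightarrow> t \<le> b \<Longrightarrow> AE x in M. \<bar>v t x\<bar> \<le> c1"
      by (auto simp: P_def)
    from trans(2) obtain c2
      where c2: "\<And>t. 0 \<le> t \<Longrightarrow> b \<le> t \<Longrightarrow> t \<le> c \<Longrightarrow> AE x in M. \<bar>v t x\<bar> \<le> c2"
      by (auto simp: P_def)
    have "AE x in M. \<bar>v t x\<bar> \<le> max c1 c2" if "0 \<le> t" "a \<le> t" "t \<le> c" for t
    proof (cases "t \<le> b")
      case True
      show ?thesis using c1[OF that(1,2) True] by eventually_elim auto
    next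
      case False
      show ?thesis using c2[OF that(1) _ that(3)] False by (auto elim!: eventually_mono)
    qed
    then show ?case unfolding P_def using \<open>c1 \<ge> 0\<close> by (intro exI[of _ "max c1 c2"]) auto
  next
    case (local t)
    then have t: "t \<in> {0..}" by simp
    from C1 t have v: "v t \<in> Linf M" "v' t \<in> Linf M"
      and d: "has_Linf_derivative M v (v' t) t {0..}"
      by (auto simp: C1_Linf_with_derivative_def)
    obtain c1 where c1: "0 \<le> c1" "AE x in M. \<bar>v t x\<bar> \<le> c1"
      using Linf_bounded[OF v(1)] .
    obtain c2 where c2: "0 \<le> c2" "AE x in M. \<bar>v' t x\<bar> \<le> c2"
      using Linf_bounded[OF v(2)] .
    obtain r where r: "r > 0" and near:
      "\<And>s. 0 \<le> s \<Longrightarrow> s \<noteq> t \<Longrightarrow> \<bar>s - t\<bar> < r \<Longrightarrow> AE x in M. \<bar>(v s x - v t x) / (s - t) - v' t x\<bar> \<le> 1"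
      using AE_derivativeD[OF has_Linf_derivative_imp_AE_derivative[OF d], of 1]
      by (auto simp: eventually_at dist_real_def)
    have *: "AE x in M. \<bar>v s x\<bar> \<le> c1 + r * (c2 + 1)" if s: "0 \<le> s" "\<bar>s - t\<bar> < r" for s
    proof (cases "s = t")
      case True
      then show ?thesis
        using c1 c2 r by (auto elim!: eventually_mono intro: add_increasing2)
    next
      case False
      from near[OF s(1) False s(2)] c1(2) c2(2) show ?thesis
      proof eventually_elim
        case (elim x)
        define q where "q = (v s x - v t x) / (s - t)"
        have "\<bar>q\<bar> \<le> c2 + 1"
          using elim unfolding q_def[symmetric] by linarith
        then have "\<bar>(s - t) * q\<bar> \<le> r * (c2 + 1)"
          unfolding abs_mult using s r by (intro mult_mono) auto
        moreover have "v s x = v t x + (s - t) * q"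
          using False by (simp add: q_def)
        ultimately show ?case using elim(2) by linarith
      qed
    qed
    have "0 \<le> c1 + r * (c2 + 1)"
      using c1 c2 r by simp
    then have "P a b" if "a \<le> t" "t \<le> b" "b - a < r" for a b
      unfolding P_def using that by (intro exI[of _ "c1 + r * (c2 + 1)"]) (auto intro!: *)
    then show ?case
      using r by auto
  qed
  then show ?thesis using that by (auto simp: P_def)
qed (auto intro: that[of 0])

section \<open>Properties of the nonlinearity\<close>

lemma C1_imp_lipschitz_on:
  fixes f :: "real \<Rightarrow> real"
  assumes "f C1_differentiable_on UNIV"
  obtains L where "L-lipschitz_on {a..b} f"
proof -
  obtain D where D: "\<And>x. (f has_vector_derivative D x) (at x)" "continuous_on UNIV D"
    using assms by (auto simp: C1_differentiable_on_def)
  have "compact (D ` {a..b})"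
    by (intro compact_continuous_image continuous_on_subset[OF D(2)]) auto
  then have "bounded (D ` {a..b})"
    by (rule compact_imp_bounded)
  then obtain L where L: "L > 0" "\<forall>y\<in>D ` {a..b}. norm y \<le> L"
    unfolding bounded_pos by blast
  have "norm (f x - f y) \<le> L * norm (x - y)" if "x \<in> {a..b}" "y \<in> {a..b}" for x y
  proof (rule field_differentiable_bound[where S="{a..b}" and f'=D])
    show "(f has_field_derivative D z) (at z within {a..b})" for z
      by (rule has_field_derivative_at_within)
        (simp add: has_real_derivative_iff_has_vector_derivative D(1))
  qed (use L(2) that in auto)
  then show ?thesis
    using L(1) by (intro that[of L] lipschitz_onI) (auto simp: dist_norm)
qed

text \<open>If \<open>s1 \<le> s_lo\<close>, then \<open>f s1 \<ge> f s_lo = f M\<close>, and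
  \<open>f M\<close> is the largest value of \<open>f\<close> to the right of \<open>m\<close>,
  while to the left of \<open>m\<close> monotonicity applies; otherwise
  \<open>s1 \<ge> s_hi > M\<close> and only the right decreasing branch is met. The bound at
  \<open>s2\<close> is the mirror image with \<open>s_hi\<close> and \<open>f m\<close>.\<close>

lemma bistable_extremal_outside:
  fixes f :: "real \<Rightarrow> real"
  assumes f: "f C1_differentiable_on UNIV" and mM: "m < M"
    and dec: "\<forall>s \<in> {..<m} \<union> {M<..}. deriv f s < 0" and inc: "\<forall>s \<in> {m<..<M}. deriv f s > 0"
    and lo: "s_lo < m" "f s_lo = f M" and hi: "M < s_hi" "f s_hi = f m"
    and out: "s1 \<notin> {s_lo<..<s_hi}" "s2 \<notin> {s_lo<..<s_hi}" and s: "s1 \<le> s" "s \<le> s2"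
  shows "f s \<le> f s1" "f s2 \<le> f s"
proof -
  have deriv: "(f has_real_derivative deriv f x) (at x)" for x
    using f by (metis C1_differentiable_on_eq DERIV_deriv_iff_real_differentiable UNIV_I)
  have cont: "continuous_on A f" for A
    using C1_differentiable_imp_continuous_on[OF f] continuous_on_subset by blast
  \<comment> \<open>The monotonicity criteria ask for the sign of the derivative in the open
    interval and for continuity, so \<open>m\<close> and \<open>M\<close> may be end points of the
    branches.\<close>
  have left: "f y \<le> f x" if "x \<le> y" "y \<le> m" for x y
  proof (rule DERIV_nonpos_imp_decreasing_open[OF that(1) _ cont])
    fix z assume "x < z" "z < y"
    then show "\<exists>d. (f has_real_derivative d) (at z) \<and> d \<le> 0"
      using deriv[of z] dec that by (intro exI[of _ "deriv f z"]) (auto intro: less_imp_le)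
  qed
  have right: "f y \<le> f x" if "x \<le> y" "M \<le> x" for x y
  proof (rule DERIV_nonpos_imp_decreasing_open[OF that(1) _ cont])
    fix z assume "x < z" "z < y"
    then show "\<exists>d. (f has_real_derivative d) (at z) \<and> d \<le> 0"
      using deriv[of z] dec that by (intro exI[of _ "deriv f z"]) (auto intro: less_imp_le)
  qed
  have mid: "f x \<le> f y" if "x \<le> y" "m \<le> x" "y \<le> M" for x y
  proof (rule DERIV_nonneg_imp_increasing_open[OF that(1) _ cont])
    fix z assume "x < z" "z < y"
    then show "\<exists>d. (f has_real_derivative d) (at z) \<and> 0 \<le> d"
      using deriv[of z] inc that by (intro exI[of _ "deriv f z"]) (auto intro: less_imp_le)
  qed
  show "f s \<le> f s1"
  proof (cases "s1 \<le> s_lo")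
    case True
    then have "f M \<le> f s1"
      using left[of s1 s_lo] lo by simp
    then show ?thesis
      using left[of s1 s] mid[of s M] right[of M s] s by linarith
  next
    case False
    then show ?thesis
      using out(1) right[of s1 s] hi(1) s by simp
  qed
  show "f s2 \<le> f s"
  proof (cases "s_hi \<le> s2")
    case True
    then have "f s2 \<le> f m"
      using right[of s_hi s2] hi by simp
    then show ?thesis
      using left[of s m] mid[of m s] right[of s s2] s by linarith
  next
    case False
    then show ?thesis
      using out(2) left[of s s2] lo(1) s by simp
  qed
qed

section \<open>Conservation and uniqueness\<close>

lemma C1_Linf_with_derivativeD:
  assumes "C1_Linf_with_derivative M {0..} u u'" "0 \<le> t"
  shows "u t \<in> Linf M" "u' t \<in> Linf M" "AE_derivative M u (u' t) (at t within {0..}) t"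
  using assms by (auto simp: C1_Linf_with_derivative_def intro: has_Linf_derivative_imp_AE_derivative)

section \<open>The domain and averages over it\<close>

locale bounded_open_domain =
  fixes \<Omega> :: "'a::euclidean_space set"
  assumes open_domain: "open \<Omega>" and bounded_domain: "bounded \<Omega>" and nonempty_domain: "\<Omega> \<noteq> {}"
begin

lemma lmeasurable_domain: "\<Omega> \<in> lmeasurable"
  using bounded_domain open_domain by (rule lmeasurable_open)

sublocale finite_measure "lebesgue_on \<Omega>"
  using lmeasurable_domain by (rule finite_measure_lebesgue_on)

lemma volume_pos: "0 < measure lebesgue \<Omega>"
  using open_not_negligible[OF open_domain nonempty_domain] negligible_iff_measure0[OF lmeasurable_domain]
  by (metis measure_nonneg order_le_less)

lemma measure_space_eq: "measure (lebesgue_on \<Omega>) (space (lebesgue_on \<Omega>)) = measure lebesgue \<Omega>"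
  using lmeasurable_domain by (simp add: measure_restrict_space fmeasurableD)

lemma emeasure_space_nonzero: "emeasure (lebesgue_on \<Omega>) (space (lebesgue_on \<Omega>)) \<noteq> 0"
  using volume_pos unfolding measure_space_eq[symmetric] by (auto simp: measure_def)

lemma average_le:
  assumes "integrable (lebesgue_on \<Omega>) g" "AE x in lebesgue_on \<Omega>. g x \<le> c"
  shows "average \<Omega> g \<le> c"
proof -
  have "(LINT x|lebesgue_on \<Omega>. g x) \<le> (LINT x|lebesgue_on \<Omega>. c)"
    using assms by (intro integral_mono_AE) auto
  then show ?thesis
    using volume_pos measure_space_eq by (simp add: average_def field_simps)
qed

lemma average_diff:
  assumes "integrable (lebesgue_on \<Omega>) g" "integrable (lebesgue_on \<Omega>) h"
  shows "average \<Omega> g - average \<Omega> h = average \<Omega> (\<lambda>x. g x - h x)"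
  using assms by (simp add: average_def algebra_simps)

lemma average_ge:
  assumes "integrable (lebesgue_on \<Omega>) g" "AE x in lebesgue_on \<Omega>. c \<le> g x"
  shows "c \<le> average \<Omega> g"
proof -
  have "average \<Omega> (\<lambda>x. - g x) \<le> - c"
    using assms by (intro average_le) auto
  then show ?thesis by (simp add: average_def)
qed

lemma integral_minus_average:
  assumes "integrable (lebesgue_on \<Omega>) g"
  shows "(LINT x|lebesgue_on \<Omega>. g x - average \<Omega> g) = 0"
  using assms volume_pos measure_space_eq by (simp add: average_def)

lemma Linf_continuous_compose:
  assumes f: "continuous_on UNIV f" and g: "g \<in> Linf (lebesgue_on \<Omega>)"
  shows "(\<lambda>x. f (g x)) \<in> Linf (lebesgue_on \<Omega>)"
proof -
  obtain c where c: "0 \<le> c" "AE x in lebesgue_on \<Omega>. \<bar>g x\<bar> \<le> c"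
    using Linf_bounded[OF g] .
  have "bounded (f ` {-c..c})"
    by (intro compact_imp_bounded compact_continuous_image continuous_on_subset[OF f]) auto
  then obtain b where b: "\<forall>y\<in>f ` {-c..c}. \<bar>y\<bar> \<le> b"
    unfolding bounded_iff real_norm_def by blast
  show ?thesis
  proof (rule LinfI)
    show "(\<lambda>x. f (g x)) \<in> borel_measurable (lebesgue_on \<Omega>)"
      using borel_measurable_continuous_onI[OF f] Linf_measurable[OF g] by measurable
    show "AE x in lebesgue_on \<Omega>. \<bar>f (g x)\<bar> \<le> b"
      using c(2) by eventually_elim (use b in \<open>auto simp: abs_le_iff\<close>)
  qed
qed

text \<open>The derivative of the integral is the integral of \<open>u'\<close>, which vanishes by
  \<open>integral_minus_average\<close>. An arbitrary solution is treated, so that both competitors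
  in the uniqueness proof are covered.\<close>

lemma solution_conserves_integral:
  assumes f: "continuous_on UNIV f" and u: "solution_P \<Omega> f u0 {0..} u"
    and u0: "u0 \<in> Linf (lebesgue_on \<Omega>)" and t: "0 \<le> t"
  shows "(LINT x|lebesgue_on \<Omega>. u t x) = (LINT x|lebesgue_on \<Omega>. u0 x)"
proof -
  let ?M = "lebesgue_on \<Omega>"
  obtain u' where C1: "C1_Linf_with_derivative ?M {0..} u u'"
    and u': "\<forall>t\<in>{0..}. AE x in ?M. u' t x = f (u t x) - average \<Omega> (\<lambda>y. f (u t y))"
    and init: "AE x in ?M. u 0 x = u0 x"
    using u unfolding solution_P_def by blast
  have ode: "AE x in ?M. u' t x = f (u t x) - average \<Omega> (\<lambda>y. f (u t y))" if "0 \<le> t" for t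
    using u' that by simp
  note Linf = C1_Linf_with_derivativeD(1,2)[OF C1] and deriv = C1_Linf_with_derivativeD(3)[OF C1]
  have "((\<lambda>s. LINT x|?M. u s x) has_real_derivative 0) (at s within {0..})"
    if s: "s \<in> {0..}" for s
  proof -
    have fu: "(\<lambda>x. f (u s x)) \<in> Linf ?M"
      using s by (intro Linf_continuous_compose[OF f] Linf(1)) simp
    have u: "u r \<in> Linf ?M" if "r \<in> {0..}" for r
      using that by (intro Linf(1)) simp
    have u': "u' s \<in> Linf ?M"
      using s by (intro Linf(2)) simp
    have "((\<lambda>s. LINT x|?M. u s x) has_real_derivative (LINT x|?M. u' s x)) (at s within {0..})"
      using s u u' by (intro has_real_derivative_integral deriv) (auto intro: integrable_Linf)
    moreover have "(LINT x|?M. u' s x) = (LINT x|?M. f (u s x) - average \<Omega> (\<lambda>y. f (u s y)))"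
      using s ode[of s] Linf_measurable[OF u'] Linf_measurable[OF fu]
      by (intro integral_cong_AE) auto
    moreover have "\<dots> = 0"
      by (rule integral_minus_average[OF integrable_Linf[OF fu]])
    ultimately show ?thesis by simp
  qed
  then obtain c where "\<forall>s\<in>{0..}. (LINT x|?M. u s x) = c"
    using has_field_derivative_zero_constant[of "{0..}" "\<lambda>s. LINT x|?M. u s x"] by auto
  then have "(LINT x|?M. u t x) = (LINT x|?M. u 0 x)"
    using t by simp
  also have "\<dots> = (LINT x|?M. u0 x)"
    using init Linf(1)[of 0] u0 by (intro integral_cong_AE) (auto intro: Linf_measurable)
  finally show ?thesis .
qed

text \<open>With \<open>E\<close> the squared L2 distance, conservation and the Lipschitz bound on
  \<open>f\<close> give \<open>E' \<le> 2 * L * E\<close> up to time \<open>T\<close>, and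
  \<open>E 0 = 0\<close>.\<close>

lemma solution_unique:
  assumes f: "f C1_differentiable_on UNIV" and u0: "u0 \<in> Linf (lebesgue_on \<Omega>)"
    and u: "solution_P \<Omega> f u0 {0..} u" and v: "solution_P \<Omega> f u0 {0..} v" and T: "0 \<le> T"
  shows "AE x in lebesgue_on \<Omega>. v T x = u T x"
proof -
  let ?M = "lebesgue_on \<Omega>"
  have cont: "continuous_on UNIV f"
    using f by (rule C1_differentiable_imp_continuous_on)
  obtain u' where u_C1: "C1_Linf_with_derivative ?M {0..} u u'"
    and u': "\<forall>t\<in>{0..}. AE x in ?M. u' t x = f (u t x) - average \<Omega> (\<lambda>y. f (u t y))"
    and u_init: "AE x in ?M. u 0 x = u0 x"
    using u unfolding solution_P_def by blast
  have u_ode: "AE x in ?M. u' t x = f (u t x) - average \<Omega> (\<lambda>y. f (u t y))" if "0 \<le> t" for t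
    using u' that by simp
  note u_Linf = C1_Linf_with_derivativeD(1,2)[OF u_C1] and u_deriv = C1_Linf_with_derivativeD(3)[OF u_C1]
  obtain v' where v_C1: "C1_Linf_with_derivative ?M {0..} v v'"
    and v': "\<forall>t\<in>{0..}. AE x in ?M. v' t x = f (v t x) - average \<Omega> (\<lambda>y. f (v t y))"
    and v_init: "AE x in ?M. v 0 x = u0 x"
    using v unfolding solution_P_def by blast
  have v_ode: "AE x in ?M. v' t x = f (v t x) - average \<Omega> (\<lambda>y. f (v t y))" if "0 \<le> t" for t
    using v' that by simp
  note v_Linf = C1_Linf_with_derivativeD(1,2)[OF v_C1] and v_deriv = C1_Linf_with_derivativeD(3)[OF v_C1]
  obtain cu where cu: "0 \<le> cu" "\<forall>t\<in>{0..T}. AE x in ?M. \<bar>u t x\<bar> \<le> cu"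
    using C1_Linf_locally_bounded[OF u_C1, of T] .
  obtain cv where cv: "0 \<le> cv" "\<forall>t\<in>{0..T}. AE x in ?M. \<bar>v t x\<bar> \<le> cv"
    using C1_Linf_locally_bounded[OF v_C1, of T] .
  \<comment> \<open>Both solutions take values in \<open>{-c..c}\<close> a.e. at every time up to
    \<open>T\<close>, so one Lipschitz constant of \<open>f\<close> serves both.\<close>
  define c where "c = max cu cv"
  obtain L where L: "L-lipschitz_on {-c..c} f"
    using C1_imp_lipschitz_on[OF f] .
  define d where "d t x = v t x - u t x" for t x
  define d' where "d' t x = v' t x - u' t x" for t x
  define E where "E t = (LINT x|?M. (d t x)\<^sup>2)" for t

  have d_Linf: "d t \<in> Linf ?M" "d' t \<in> Linf ?M" if "0 \<le> t" for t
  proof -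
    show "d t \<in> Linf ?M" "d' t \<in> Linf ?M"
      using Linf_diff[OF v_Linf(1) u_Linf(1)] Linf_diff[OF v_Linf(2) u_Linf(2)] that
      by (simp_all add: d_def[abs_def] d'_def[abs_def])
  qed
  have mult_int: "integrable ?M (\<lambda>x. g x * h x)" if g: "g \<in> Linf ?M" and h: "h \<in> Linf ?M" for g h
    using g h by (intro integrable_Linf Linf_mult)
  have sq_int: "integrable ?M (\<lambda>x. (d t x)\<^sup>2)" if "0 \<le> t" for t
    using mult_int[OF d_Linf(1) d_Linf(1)] that by (simp add: power2_eq_square)

  have E_deriv: "(E has_real_derivative 2 * (LINT x|?M. d t x * d' t x)) (at t within {0..})"
    if t: "0 \<le> t" for t
  proof -
    obtain a where a: "0 \<le> a" "AE x in ?M. \<bar>d t x\<bar> \<le> a" using Linf_bounded[OF d_Linf(1)[OF t]] .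
    obtain b where b: "0 \<le> b" "AE x in ?M. \<bar>d' t x\<bar> \<le> b" using Linf_bounded[OF d_Linf(2)[OF t]] .
    have "AE_derivative ?M d (d' t) (at t within {0..}) t"
      using AE_derivative_diff[OF v_deriv u_deriv, OF t t] by (simp add: d_def[abs_def] d'_def[abs_def])
    then have "AE_derivative ?M (\<lambda>s x. (d s x)\<^sup>2) (\<lambda>x. 2 * (d t x * d' t x)) (at t within {0..}) t"
    proof (rule AE_derivative_square[where c="max a b"])
      show "AE x in ?M. \<bar>d t x\<bar> \<le> max a b" using a(2) by eventually_elim auto
      show "AE x in ?M. \<bar>d' t x\<bar> \<le> max a b" using b(2) by eventually_elim auto
    qed (use a in auto)
    then have "((\<lambda>s. LINT x|?M. (d s x)\<^sup>2) has_real_derivative (LINT x|?M. 2 * (d t x * d' t x)))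
        (at t within {0..})"
      by (rule has_real_derivative_integral)
        (use t in \<open>auto intro!: sq_int mult_int d_Linf integrable_mult_right\<close>)
    then show ?thesis
      by (simp add: E_def[abs_def])
  qed

  have E_bound: "(LINT x|?M. d t x * d' t x) \<le> L * E t" if t: "0 \<le> t" "t \<le> T" for t
  proof -
    have tT: "t \<in> {0..T}" using t by simp
    \<comment> \<open>\<open>k\<close> does not depend on \<open>x\<close> and \<open>d t\<close>
      has integral zero by conservation, so the term \<open>d t x * k\<close> integrates to
      zero.\<close>
    define k where "k = average \<Omega> (\<lambda>y. f (v t y)) - average \<Omega> (\<lambda>y. f (u t y))"
    have mean: "(LINT x|?M. d t x) = 0"
      unfolding d_def
      using solution_conserves_integral[OF cont u u0 t(1)] solution_conserves_integral[OF cont v u0 t(1)]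
        integrable_Linf[OF u_Linf(1)[OF t(1)]] integrable_Linf[OF v_Linf(1)[OF t(1)]]
      by simp
    have fd: "integrable ?M (\<lambda>x. d t x * f (w x))" if "w \<in> Linf ?M" for w
      using mult_int[OF d_Linf(1)[OF t(1)] Linf_continuous_compose[OF cont that]] .
    have int: "integrable ?M (\<lambda>x. d t x * (f (v t x) - f (u t x)))"
      using Bochner_Integration.integrable_diff[OF fd[OF v_Linf(1)] fd[OF u_Linf(1)], OF t(1) t(1)]
      by (simp add: right_diff_distrib)
    have "AE x in ?M. d t x * d' t x = d t x * (f (v t x) - f (u t x)) - d t x * k"
      using v_ode[OF t(1)] u_ode[OF t(1)]
    proof eventually_elim
      case (elim x)
      show ?case
        unfolding d'_def k_def elim by (simp add: algebra_simps)
    qed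
    then have "(LINT x|?M. d t x * d' t x) = (LINT x|?M. d t x * (f (v t x) - f (u t x)) - d t x * k)"
      using int integrable_Linf[OF d_Linf(1)[OF t(1)]] mult_int[OF d_Linf, OF t(1) t(1)]
      by (intro integral_cong_AE) (auto intro: borel_measurable_integrable)
    also have "\<dots> = (LINT x|?M. d t x * (f (v t x) - f (u t x)))"
      using int integrable_Linf[OF d_Linf(1)[OF t(1)]] mean by simp
    also have "\<dots> \<le> (LINT x|?M. L * (d t x)\<^sup>2)"
    proof (rule integral_mono_AE[OF int])
      show "integrable ?M (\<lambda>x. L * (d t x)\<^sup>2)"
        using sq_int[OF t(1)] by simp
      show "AE x in ?M. d t x * (f (v t x) - f (u t x)) \<le> L * (d t x)\<^sup>2"
        using bspec[OF cu(2) tT] bspec[OF cv(2) tT]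
      proof eventually_elim
        case (elim x)
        have "v t x \<in> {-c..c}" "u t x \<in> {-c..c}"
          using elim by (auto simp: c_def)
        from lipschitz_onD[OF L this] have "\<bar>f (v t x) - f (u t x)\<bar> \<le> L * \<bar>d t x\<bar>"
          by (simp add: d_def dist_real_def)
        then have "\<bar>d t x\<bar> * \<bar>f (v t x) - f (u t x)\<bar> \<le> \<bar>d t x\<bar> * (L * \<bar>d t x\<bar>)"
          by (rule mult_left_mono) simp
        also have "\<dots> = L * (d t x)\<^sup>2"
          by (simp add: power2_eq_square)
        finally show ?case
          by (metis abs_ge_self abs_mult order_trans)
      qed
    qed
    finally show ?thesis
      by (simp add: E_def)
  qed

  \<comment> \<open>Integrating factor for \<open>E' \<le> 2 * L * E\<close>: \<open>G\<close> does
    not increase up to time \<open>T\<close>.\<close>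
  define G where "G t = exp (- 2 * L * t) * E t" for t
  have G_deriv: "(G has_real_derivative
      exp (- 2 * L * t) * (2 * (LINT x|?M. d t x * d' t x)) - 2 * L * exp (- 2 * L * t) * E t)
      (at t within {0..})" if "0 \<le> t" for t
    unfolding G_def[abs_def]
    by (auto intro!: derivative_eq_intros E_deriv that)
  have "G T \<le> G 0"
  proof (rule DERIV_nonpos_imp_decreasing_open[OF T])
    fix s assume s: "0 < s" "s < T"
    have "at s within {0..} = at s"
      using s by (intro at_within_interior) simp
    moreover have "exp (- 2 * L * s) * (2 * (LINT x|?M. d s x * d' s x)) - 2 * L * exp (- 2 * L * s) * E s
        = 2 * exp (- 2 * L * s) * ((LINT x|?M. d s x * d' s x) - L * E s)"
      by (simp add: algebra_simps)
    moreover have "\<dots> \<le> 0"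
      using E_bound[of s] s by (intro mult_nonneg_nonpos) auto
    ultimately show "\<exists>y. (G has_real_derivative y) (at s) \<and> y \<le> 0"
      using G_deriv[of s] s by (metis less_imp_le)
  next
    have "continuous_on {0..} G"
      using G_deriv by (intro DERIV_continuous_on) auto
    then show "continuous_on {0..T} G"
      by (rule continuous_on_subset) auto
  qed
  moreover have "E 0 = 0"
  proof -
    have "AE x in ?M. (d 0 x)\<^sup>2 = 0"
      using u_init v_init by eventually_elim (simp add: d_def)
    then show ?thesis
      unfolding E_def using sq_int[of 0] by (subst integral_nonneg_eq_0_iff_AE) auto
  qed
  moreover have "0 \<le> E T"
    unfolding E_def by simp
  ultimately have "E T = 0"
    by (simp add: G_def mult_le_0_iff)
  then have "AE x in ?M. (d T x)\<^sup>2 = 0"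
    unfolding E_def using sq_int[OF T] by (subst (asm) integral_nonneg_eq_0_iff_AE) auto
  then show ?thesis
    by eventually_elim (simp add: d_def)
qed

end

section \<open>Existence\<close>

text \<open>Completeness makes the bounded continuous functions an admissible phase space for
  \<open>invariant_euler_scheme\<close>.\<close>

instance bcontfun :: (metric_space, banach) banach ..

context bounded_open_domain
begin

text \<open>The equation is solved for curves of functions of the initial value, in a Banach space
  whose elements have values everywhere; composition with \<open>u0\<close> does not increase norms,
  hence carries derivative and continuity over to \<open>Linf_norm\<close>.\<close>

lemma solution_exists:
  assumes f: "f C1_differentiable_on UNIV" and u0: "u0 \<in> Linf (lebesgue_on \<Omega>)"
    and s12: "s1 \<le> s2" and u0_range: "AE x in lebesgue_on \<Omega>. s1 \<le> u0 x \<and> u0 x \<le> s2"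
    and extremal: "\<And>s. s \<in> {s1..s2} \<Longrightarrow> f s \<le> f s1 \<and> f s2 \<le> f s"
  shows "\<exists>u. solution_P \<Omega> f u0 {0..} u \<and>
    (\<forall>t\<ge>0. AE x in lebesgue_on \<Omega>. s1 \<le> u t x \<and> u t x \<le> s2)"
proof -
  let ?M = "lebesgue_on \<Omega>"
  have cont: "continuous_on UNIV f"
    using f by (rule C1_differentiable_imp_continuous_on)
  obtain L where L: "L-lipschitz_on {s1..s2} f"
    using C1_imp_lipschitz_on[OF f] .
  have L_nonneg: "0 \<le> L"
    using L by (rule lipschitz_on_nonneg)
  define C where "C = max \<bar>f s1\<bar> \<bar>f s2\<bar>"
  have C: "\<bar>f s\<bar> \<le> C" if "s \<in> {s1..s2}" for s
    using extremal[OF that] by (auto simp: C_def)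
  \<comment> \<open>The argument \<open>u0 x\<close> makes \<open>avg Y\<close> the average of
    \<open>f(u)\<close> for \<open>u = Y \<circ> u0\<close>, so the lifted equation keeps the actual
    nonlocal term.\<close>
  define avg where "avg Y = average \<Omega> (\<lambda>x. f (apply_bcontfun Y (u0 x)))" for Y :: "real \<Rightarrow>\<^sub>C real"
  define F where "F Y = Bcontfun (\<lambda>s. f (apply_bcontfun Y s) - avg Y)" for Y :: "real \<Rightarrow>\<^sub>C real"
  define K :: "(real \<Rightarrow>\<^sub>C real) set" where "K = PiC UNIV (\<lambda>_. {s1..s2})"
  have K: "Y \<in> K \<longleftrightarrow> (\<forall>s. apply_bcontfun Y s \<in> {s1..s2})" for Y
    by (auto simp: K_def mem_PiC_iff)

  have cont_f: "continuous_on UNIV (\<lambda>s. f (apply_bcontfun Y s))" for Y :: "real \<Rightarrow>\<^sub>C real"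
    by (rule continuous_on_compose2[OF cont continuous_on_apply_bcontfun]) simp
  have F: "apply_bcontfun (F Y) s = f (apply_bcontfun Y s) - avg Y" for Y s
  proof -
    obtain r where r: "\<forall>y\<in>range (apply_bcontfun Y). \<bar>y\<bar> \<le> r"
      using bounded_apply_bcontfun[of Y] unfolding bounded_iff real_norm_def by blast
    have "compact (f ` {-r..r})"
      by (intro compact_continuous_image continuous_on_subset[OF cont]) auto
    then have "bounded (f ` {-r..r})"
      by (rule compact_imp_bounded)
    then obtain b where b: "\<forall>y\<in>f ` {-r..r}. \<bar>y\<bar> \<le> b"
      unfolding bounded_iff real_norm_def by blast
    have "\<bar>f (apply_bcontfun Y s)\<bar> \<le> b" for s
    proof -
      have "apply_bcontfun Y s \<in> {-r..r}"
        using r by (auto simp: abs_le_iff minus_le_iff)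
      then show ?thesis using b by blast
    qed
    then have "norm (f (apply_bcontfun Y s) - avg Y) \<le> b + \<bar>avg Y\<bar>" for s
      by (smt (verit) real_norm_def)
    then have "(\<lambda>s. f (apply_bcontfun Y s) - avg Y) \<in> bcontfun"
      by (intro bcontfun_normI continuous_intros cont_f)
    then show ?thesis
      by (simp add: F_def Bcontfun_inverse)
  qed
  have int: "integrable ?M (\<lambda>x. f (apply_bcontfun Y (u0 x)))" for Y :: "real \<Rightarrow>\<^sub>C real"
    by (rule integrable_Linf[OF Linf_continuous_compose[OF cont_f u0]])
  have avg: "f s2 \<le> avg Y" "avg Y \<le> f s1" if "Y \<in> K" for Y
    unfolding avg_def using that extremal
    by (auto intro!: average_ge average_le int simp: K simp del: atLeastAtMost_iff)
  have lip: "\<bar>f (apply_bcontfun Y s) - f (apply_bcontfun Z s)\<bar> \<le> L * dist Y Z"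
    if "Y \<in> K" "Z \<in> K" for Y Z s
  proof -
    have "\<bar>f (apply_bcontfun Y s) - f (apply_bcontfun Z s)\<bar> \<le> L * dist (apply_bcontfun Y s) (apply_bcontfun Z s)"
      using lipschitz_onD[OF L, of "apply_bcontfun Y s" "apply_bcontfun Z s"] that
      unfolding K dist_real_def by blast
    also have "\<dots> \<le> L * dist Y Z"
      by (intro mult_left_mono dist_bounded L_nonneg)
    finally show ?thesis .
  qed

  \<comment> \<open>In \<open>2 * L\<close> and \<open>2 * C\<close> one half stems from
    \<open>f\<close>, the other from its average. The step bound \<open>1 / (L + 1)\<close> ensures
    \<open>h * L \<le> 1\<close> and stays meaningful for \<open>L = 0\<close>.\<close>
  interpret invariant_euler_scheme K F "2 * L" "2 * C" "1 / (L + 1)"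
  proof
    show "closed K"
      unfolding K_def by (rule closed_PiC) auto
    show "(2 * L)-lipschitz_on K F"
    proof (rule lipschitz_onI)
      fix Y Z assume YZ: "Y \<in> K" "Z \<in> K"
      have bounds: "f (apply_bcontfun Y s) - f (apply_bcontfun Z s) \<le> L * dist Y Z"
          "- (L * dist Y Z) \<le> f (apply_bcontfun Y s) - f (apply_bcontfun Z s)" for s
        using lip[OF YZ, of s] by linarith+
      have "avg Y - avg Z = average \<Omega> (\<lambda>x. f (apply_bcontfun Y (u0 x)) - f (apply_bcontfun Z (u0 x)))"
        unfolding avg_def by (rule average_diff[OF int int])
      moreover have "\<dots> \<le> L * dist Y Z"
        by (intro average_le Bochner_Integration.integrable_diff int AE_I2 bounds)
      moreover have "- (L * dist Y Z) \<le> average \<Omega> (\<lambda>x. f (apply_bcontfun Y (u0 x)) - f (apply_bcontfun Z (u0 x)))"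
        by (intro average_ge Bochner_Integration.integrable_diff int AE_I2 bounds)
      ultimately have "\<bar>avg Y - avg Z\<bar> \<le> L * dist Y Z"
        by linarith
      then have "dist (apply_bcontfun (F Y) s) (apply_bcontfun (F Z) s) \<le> 2 * L * dist Y Z" for s
        using lip[OF YZ, of s] unfolding dist_real_def F by linarith
      then show "dist (F Y) (F Z) \<le> 2 * L * dist Y Z"
        by (rule dist_bound)
    qed (use L_nonneg in simp)
    show "0 < 1 / (L + 1)"
      using L_nonneg by simp
    show "norm (F Y) \<le> 2 * C" if Y: "Y \<in> K" for Y
    proof (rule norm_bound)
      fix s
      have "\<bar>f (apply_bcontfun Y s)\<bar> \<le> C"
        using Y C unfolding K by blast
      moreover have "\<bar>avg Y\<bar> \<le> C"
        using avg[OF Y] by (auto simp: C_def)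
      ultimately show "norm (apply_bcontfun (F Y) s) \<le> 2 * C"
        unfolding F real_norm_def by linarith
    qed
    show "Y + h *\<^sub>R F Y \<in> K" if Y: "Y \<in> K" and h: "0 \<le> h" "h \<le> 1 / (L + 1)" for Y h
      unfolding K
    proof
      fix s
      define y where "y = apply_bcontfun Y s"
      have y: "y \<in> {s1..s2}"
        using Y unfolding K y_def by blast
      have "h * (L + 1) \<le> 1"
        using h L_nonneg by (simp add: pos_le_divide_eq)
      then have hL: "h * L \<le> 1"
        using h by (simp add: distrib_left)
      \<comment> \<open>Since \<open>h * L \<le> 1\<close>, a step driven by
        \<open>f y - f z\<close> cannot carry \<open>y\<close> past \<open>z\<close>. As
        \<open>f s2 \<le> avg Y \<le> f s1\<close>, the actual step lies between those for
        \<open>z = s1\<close> and \<open>z = s2\<close>, so it stays in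
        \<open>{s1..s2}\<close>.\<close>
      have *: "h * \<bar>f y - f z\<bar> \<le> \<bar>y - z\<bar>" if "z \<in> {s1..s2}" for z
      proof -
        have "h * \<bar>f y - f z\<bar> \<le> h * (L * \<bar>y - z\<bar>)"
          using lipschitz_onD[OF L y that] h by (intro mult_left_mono) (auto simp: dist_real_def)
        also have "\<dots> \<le> 1 * \<bar>y - z\<bar>"
          using hL by (subst mult.assoc[symmetric], intro mult_right_mono) auto
        finally show ?thesis by simp
      qed
      have "h * (f s1 - f y) \<le> y - s1" "h * (f y - f s2) \<le> s2 - y"
        using *[of s1] *[of s2] extremal[OF y] y s12 by auto
      moreover have "h * (f y - f s1) \<le> h * (f y - avg Y)" "h * (f y - avg Y) \<le> h * (f y - f s2)"
        using h avg[OF Y] by (auto intro!: mult_left_mono)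
      ultimately show "apply_bcontfun (Y + h *\<^sub>R F Y) s \<in> {s1..s2}"
        by (simp add: plus_bcontfun.rep_eq scaleR_bcontfun.rep_eq F flip: y_def) (auto simp: algebra_simps)
    qed
  qed

  \<comment> \<open>The identity, clipped so as to be bounded and to lie in \<open>K\<close>; on the
    a.e. range of \<open>u0\<close> it is unchanged, which gives the initial condition.\<close>
  define Y0 :: "real \<Rightarrow>\<^sub>C real" where "Y0 = Bcontfun (\<lambda>s. max s1 (min s2 s))"
  have Y0: "apply_bcontfun Y0 s = max s1 (min s2 s)" for s
  proof -
    have "(\<lambda>s. max s1 (min s2 s)) \<in> bcontfun"
      by (rule bcontfun_normI[where b="max \<bar>s1\<bar> \<bar>s2\<bar>"]) (use s12 in \<open>auto intro!: continuous_intros\<close>)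
    then show ?thesis
      by (simp add: Y0_def Bcontfun_inverse)
  qed
  have Y0_K: "Y0 \<in> K"
    using s12 by (auto simp: K Y0)

  define u where "u t x = apply_bcontfun (flow Y0 t) (u0 x)" for t x
  define u' where "u' t x = apply_bcontfun (F (flow Y0 t)) (u0 x)" for t x
  have Linf: "(\<lambda>x. apply_bcontfun Y (u0 x)) \<in> Linf ?M" for Y :: "real \<Rightarrow>\<^sub>C real"
    by (rule Linf_continuous_compose[OF continuous_on_apply_bcontfun u0])
  have tendsto: "((\<lambda>s. Linf_norm ?M (\<lambda>x. apply_bcontfun (G s) (u0 x))) \<longlongrightarrow> 0) A"
    if "(G \<longlongrightarrow> 0) A" for G :: "real \<Rightarrow> real \<Rightarrow>\<^sub>C real" and A
  proof (rule Linf_norm_tendsto_0I[OF emeasure_space_nonzero])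
    show "((\<lambda>s. norm (G s)) \<longlongrightarrow> 0) A"
      using that by (rule tendsto_norm_zero)
    show "\<forall>\<^sub>F s in A. \<forall>x. \<bar>apply_bcontfun (G s) (u0 x)\<bar> \<le> norm (G s)"
      by (intro always_eventually allI) (metis norm_bounded real_norm_def)
  qed (rule Linf_measurable[OF Linf])
  have deriv: "(flow Y0 has_vector_derivative F (flow Y0 t)) (at t within {0..})" if "0 \<le> t" for t
    using flow_has_vector_derivative[OF Y0_K that] .

  have "has_Linf_derivative ?M u (u' t) t {0..}" if t: "0 \<le> t" for t
  proof -
    have "((\<lambda>s. norm (flow Y0 s - flow Y0 t - (s - t) *\<^sub>R F (flow Y0 t)) / norm (s - t)) \<longlongrightarrow> 0)
        (at t within {0..})"
      using deriv[OF t] unfolding has_vector_derivative_def has_derivative_iff_norm by blast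
    moreover have "\<forall>\<^sub>F s in at t within {0..}.
        norm (flow Y0 s - flow Y0 t - (s - t) *\<^sub>R F (flow Y0 t)) / norm (s - t)
          = norm ((flow Y0 s - flow Y0 t) /\<^sub>R (s - t) - F (flow Y0 t))"
    proof -
      have "norm (flow Y0 s - flow Y0 t - (s - t) *\<^sub>R F (flow Y0 t)) / norm (s - t)
          = norm ((flow Y0 s - flow Y0 t) /\<^sub>R (s - t) - F (flow Y0 t))" if "s \<noteq> t" for s
      proof -
        have "(flow Y0 s - flow Y0 t) /\<^sub>R (s - t) - F (flow Y0 t)
            = (flow Y0 s - flow Y0 t - (s - t) *\<^sub>R F (flow Y0 t)) /\<^sub>R (s - t)"
          using that by (simp add: scaleR_diff_right)
        then show ?thesis
          by (simp add: divide_inverse mult.commute)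
      qed
      then show ?thesis
        by (auto simp: eventually_at_filter)
    qed
    ultimately have "((\<lambda>s. norm ((flow Y0 s - flow Y0 t) /\<^sub>R (s - t) - F (flow Y0 t))) \<longlongrightarrow> 0)
        (at t within {0..})"
      by (rule Lim_transform_eventually)
    then have "((\<lambda>s. (flow Y0 s - flow Y0 t) /\<^sub>R (s - t) - F (flow Y0 t)) \<longlongrightarrow> 0) (at t within {0..})"
      by (rule tendsto_norm_zero_cancel)
    from tendsto[OF this] show ?thesis
      unfolding has_Linf_derivative_def u_def u'_def
      by (simp add: minus_bcontfun.rep_eq scaleR_bcontfun.rep_eq divide_inverse mult.commute)
  qed
  moreover have "continuous_on_Linf ?M {0..} u'"
    unfolding continuous_on_Linf_def
  proof
    fix t :: real assume t: "t \<in> {0..}"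
    have "continuous_on {0..} (flow Y0)"
      using deriv by (intro continuous_on_vector_derivative) auto
    then have "continuous_on {0..} (\<lambda>s. F (flow Y0 s))"
      using flow_in_K[OF Y0_K] by (intro continuous_on_compose2[OF lipschitz_on_continuous_on[OF lipschitz]]) auto
    then have "((\<lambda>s. F (flow Y0 s)) \<longlongrightarrow> F (flow Y0 t)) (at t within {0..})"
      using t by (simp add: continuous_on_def)
    then have "((\<lambda>s. F (flow Y0 s) - F (flow Y0 t)) \<longlongrightarrow> 0) (at t within {0..})"
      by (rule LIM_zero)
    from tendsto[OF this] show "((\<lambda>s. Linf_norm ?M (\<lambda>x. u' s x - u' t x)) \<longlongrightarrow> 0) (at t within {0..})"
      unfolding u'_def by (simp add: minus_bcontfun.rep_eq)
  qed
  moreover have "u t \<in> Linf ?M" "u' t \<in> Linf ?M" for t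
    unfolding u_def[abs_def] u'_def[abs_def] by (rule Linf)+
  ultimately have "C1_Linf_with_derivative ?M {0..} u u'"
    by (simp add: C1_Linf_with_derivative_def)
  moreover have "u' t x = f (u t x) - average \<Omega> (\<lambda>y. f (u t y))" for t x
    by (simp add: u_def u'_def F avg_def)
  moreover have "AE x in ?M. u 0 x = u0 x"
    using u0_range by eventually_elim (simp add: u_def flow_0[OF Y0_K] Y0)
  ultimately have "solution_P \<Omega> f u0 {0..} u"
    unfolding solution_P_def by (intro conjI exI[of _ u']) auto
  moreover have "s1 \<le> u t x \<and> u t x \<le> s2" if "0 \<le> t" for t x
    using flow_in_K[OF Y0_K that] by (simp add: K u_def)
  ultimately show ?thesis
    by (intro exI[of _ u]) auto
qed

end

theorem theorem1p1:
  fixes \<Omega> :: "(real ^ 'n) set" and f :: "real \<Rightarrow> real"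
    and m M s_lo s_hi s1 s2 :: real and u0 :: "real ^ 'n \<Rightarrow> real"
  assumes "open \<Omega>" and "bounded \<Omega>" and "\<Omega> \<noteq> {}"
    and "f C1_differentiable_on UNIV"
    and "m < M" and "deriv f m = 0" and "deriv f M = 0"
    and "\<forall>s \<in> {..<m} \<union> {M<..}. deriv f s < 0"
    and "\<forall>s \<in> {m<..<M}. deriv f s > 0"
    and "s_lo < m" and "M < s_hi" and "f s_lo = f M" and "f s_hi = f m"
    and "u0 \<in> Linf (lebesgue_on \<Omega>)"
    and "s1 < s2" and "s1 \<notin> {s_lo<..<s_hi}" and "s2 \<notin> {s_lo<..<s_hi}"
    and "AE x in lebesgue_on \<Omega>. s1 \<le> u0 x \<and> u0 x \<le> s2"
  shows "\<exists>u. solution_P \<Omega> f u0 {0..} u \<and>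
      (\<forall>v. solution_P \<Omega> f u0 {0..} v \<longrightarrow> (\<forall>t\<ge>0. AE x in lebesgue_on \<Omega>. v t x = u t x)) \<and>
      (\<forall>t\<ge>0. (LINT x|lebesgue_on \<Omega>. u t x) = (LINT x|lebesgue_on \<Omega>. u0 x)) \<and>
      (\<forall>t\<ge>0. AE x in lebesgue_on \<Omega>. s1 \<le> u t x \<and> u t x \<le> s2)"
proof -
  interpret bounded_open_domain \<Omega>
    using assms(1-3) by unfold_locales
  \<comment> \<open>Here the bistable shape of \<open>f\<close> and the position of
    \<open>s1\<close> and \<open>s2\<close> are turned into the hypothesis that makes small Euler
    steps preserve \<open>{s1..s2}\<close>.\<close>
  have "f s \<le> f s1 \<and> f s2 \<le> f s" if "s \<in> {s1..s2}" for s
    using bistable_extremal_outside[OF assms(4,5,8,9,10,12,11,13,16,17)] that by simp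
  then obtain u where u: "solution_P \<Omega> f u0 {0..} u"
      "\<forall>t\<ge>0. AE x in lebesgue_on \<Omega>. s1 \<le> u t x \<and> u t x \<le> s2"
    using solution_exists[OF assms(4,14) less_imp_le[OF assms(15)] assms(18)] by blast
  show ?thesis
    using u solution_unique[OF assms(4,14) u(1)]
      solution_conserves_integral[OF C1_differentiable_imp_continuous_on[OF assms(4)] u(1) assms(14)]
    by (intro exI[of _ u]) auto
qed

end
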